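(* There is an absolute constant $c>0$ such that the following holds. Let $x\ge 1$, $\alpha\in\mathbb{R}$, and let $f:\mathbb{Z}\to\mathbb{C}$ be supported on $[1,x]$. Let $1\le y\le x$ and $1\le Q\le x^{1/2}$, and let $$\mathcal{A}:=\left\{\tfrac{a}{q}\ :\ a\in\mathbb{Z},\ 1\le q\le Q,\ (a,q)=1,\ \left|\alpha-\tfrac{a}{q}\right|\le\tfrac{1}{6y}\right\}.$$ Then $$\sum_{\substack{n\in\mathbb{Z}\\ -y<n\le x}}\big|F(n,n+y;\alpha)\big|^2\ \ge\ c\,\frac{y^2}{x}\sum_{\frac{a}{q}\in\mathcal{A}}\big|F(x;a/q)\big|^2 .$$
   Context: $\mathrm{e}(\beta):=e^{2\pi i\beta}$. For real $t,\beta$, $F(t;\beta):=\sum_{m\le t} f(m)\mathrm{e}(\beta m)$ (sum over integers $m$), and for an integer $n$ and real $y$, $F(n,n+y;\beta):=F(n+y;\beta)-F(n;\beta)=\sum_{n<m\le n+y} f(m)\mathrm{e}(\beta m)$. *)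

theory Defs
  imports "HOL-Analysis.Analysis"
begin

definition e :: "real \<Rightarrow> complex" where
  "e \<beta> = exp (2 * complex_of_real pi * \<i> * complex_of_real \<beta>)"

text \<open>
  The index set of \<open>F\<close> is infinite, hence \<open>infsum\<close> (the finite \<open>sum\<close> would be \<open>0\<close> there);
  for finitely supported \<open>f\<close> the series has only finitely many nonzero terms.
\<close>

definition F :: "(int \<Rightarrow> complex) \<Rightarrow> real \<Rightarrow> real \<Rightarrow> complex" where
  "F f t \<beta> = (\<Sum>\<^sub>\<infinity>m\<in>{m::int. real_of_int m \<le> t}. f m * e (\<beta> * real_of_int m))"

definition F_between :: "(int \<Rightarrow> complex) \<Rightarrow> real \<Rightarrow> real \<Rightarrow> real \<Rightarrow> complex" where
  "F_between f s t \<beta> = F f t \<beta> - F f s \<beta>"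

text \<open>
  A set of real numbers, so each fraction occurs once.
\<close>

definition near_fractions :: "real \<Rightarrow> real \<Rightarrow> real \<Rightarrow> real set" where
  "near_fractions \<alpha> y Q =
     {real_of_int a / real_of_int q | a q :: int.
        1 \<le> q \<and> real_of_int q \<le> Q \<and> coprime a q \<and>
        \<bar>\<alpha> - real_of_int a / real_of_int q\<bar> \<le> 1 / (6 * y)}"

end

theory Submission imports Defs begin

text \<open>
  For \<open>r\<close> in the given set of fractions, the exponential sum of the short sums at frequency
  \<open>r - \<alpha>\<close> is \<open>F(x; r)\<close> times a geometric sum with \<open>\<lfloor>y\<rfloor>\<close> terms. Since
  \<open>\<bar>r - \<alpha>\<bar> \<le> 1 / (6 y)\<close>, all these terms have real part at least \<open>1 / 2\<close>, so the factor is at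
  least \<open>y / 4\<close> in modulus. The fractions are \<open>1 / x\<close>-spaced because \<open>Q\<^sup>2 \<le> x\<close>, and modulo 1 too
  because they lie in an interval of length at most \<open>1 / 3\<close>; the large sieve inequality then
  bounds the sum over them by a multiple of \<open>x\<close> times the sum of the squared short sums.
\<close>

section \<open>The additive character and its geometric sums\<close>

lemma e_eq_exp: "e t = exp (\<i> * of_real (2 * pi * t))"
  by (simp add: e_def mult_ac)

lemma e_add: "e (s + t) = e s * e t"
  by (simp add: e_def exp_add [symmetric] algebra_simps)

lemma e_0 [simp]: "e 0 = 1"
  by (simp add: e_def)

lemma norm_e [simp]: "norm (e t) = 1"
  unfolding e_eq_exp by (rule norm_exp_i_times)

lemma cnj_e: "cnj (e t) = e (- t)"
  by (simp add: e_def exp_cnj)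

lemma Re_e: "Re (e t) = cos (2 * pi * t)"
  by (simp add: e_eq_exp Re_exp)

text \<open>The left factor comes from \<open>norm (e t - 1) = 2 * \<bar>sin (pi * t)\<bar>\<close>,
  the bound \<open>x / 2 \<le> sin x\<close> on \<open>[0, pi / 3]\<close>, and
  \<open>pi > 3\<close>. The bound on \<open>sin\<close> holds because \<open>sin u - u / 2\<close>
  has derivative \<open>cos u - 1 / 2\<close>, nonnegative there.\<close>

lemma norm_e_minus_1_ge:
  assumes "\<bar>t\<bar> \<le> 1 / 3"
  shows "3 * \<bar>t\<bar> \<le> norm (e t - 1)"
proof -
  have *: "x / 2 \<le> sin x" if "0 \<le> x" "x \<le> pi / 3" for x :: real
  proof -
    have "(\<lambda>u. sin u - u / 2) 0 \<le> (\<lambda>u. sin u - u / 2) x"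
    proof (rule DERIV_nonneg_imp_nondecreasing [OF that(1)])
      fix u assume u: "0 \<le> u" "u \<le> x"
      have "cos (pi / 3) \<le> cos u"
        using u that pi_gt_zero by (intro cos_monotone_0_pi_le) auto
      then have "0 \<le> cos u - 1 / 2"
        by (simp add: cos_60)
      moreover have "((\<lambda>u. sin u - u / 2) has_real_derivative cos u - 1 / 2) (at u)"
        by (auto intro!: derivative_eq_intros)
      ultimately show "\<exists>y. ((\<lambda>u. sin u - u / 2) has_real_derivative y) (at u) \<and> 0 \<le> y"
        by blast
    qed
    then show ?thesis by simp
  qed
  have "pi * \<bar>t\<bar> / 2 \<le> sin (pi * \<bar>t\<bar>)"
  proof (rule *)
    show "pi * \<bar>t\<bar> \<le> pi / 3"
      using mult_left_mono [OF assms, of pi] by simp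
  qed simp
  also have "\<dots> \<le> \<bar>sin (pi * t)\<bar>"
    by (auto simp: abs_if)
  finally have "pi * \<bar>t\<bar> \<le> 2 * \<bar>sin (pi * t)\<bar>" by simp
  moreover have "norm (e t - 1) = 2 * \<bar>sin (pi * t)\<bar>"
    using dist_exp_i_1 [of "2 * pi * t"] by (simp add: e_eq_exp)
  moreover have "3 * \<bar>t\<bar> \<le> pi * \<bar>t\<bar>"
    using pi_gt3 by (intro mult_right_mono) auto
  ultimately show ?thesis by simp
qed

text \<open>Multiplying by \<open>e t - 1\<close> telescopes the sum to a difference of two unit
  vectors, so the bound does not depend on \<open>m\<close>.\<close>

lemma norm_geometric_e_le:
  fixes m :: nat
  assumes "t \<noteq> 0" "\<bar>t\<bar> \<le> 1 / 3"
  shows "norm (\<Sum>k<m. e (t * real k)) \<le> 2 / (3 * \<bar>t\<bar>)"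
proof -
  have "(\<Sum>k<m. e (t * real k)) * (e t - 1) = e (t * real m) - 1"
    by (induction m) (simp_all add: e_add algebra_simps)
  then have "norm (\<Sum>k<m. e (t * real k)) * norm (e t - 1) = norm (e (t * real m) - 1)"
    by (metis norm_mult)
  also have "\<dots> \<le> 2"
    using norm_triangle_ineq4 [of "e (t * real m)" 1] by simp
  finally have "norm (\<Sum>k<m. e (t * real k)) * norm (e t - 1) \<le> 2" .
  moreover have "norm (\<Sum>k<m. e (t * real k)) * (3 * \<bar>t\<bar>) \<le> norm (\<Sum>k<m. e (t * real k)) * norm (e t - 1)"
    by (intro mult_left_mono norm_e_minus_1_ge assms) auto
  ultimately show ?thesis
    using assms(1) by (simp add: field_simps)
qed

text \<open>All arguments stay within \<open>pi / 3\<close> of 0, so each term has real part at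
  least \<open>1 / 2\<close> and nothing cancels.\<close>

lemma norm_geometric_e_ge:
  fixes m :: nat
  assumes "\<And>j. j \<in> {1..m} \<Longrightarrow> \<bar>t\<bar> * real j \<le> 1 / 6"
  shows "real m / 2 \<le> norm (\<Sum>j=1..m. e (- t * real j))"
proof -
  have "1 / 2 \<le> Re (e (- t * real j))" if "j \<in> {1..m}" for j
  proof -
    have "2 * pi * (\<bar>t\<bar> * real j) \<le> 2 * pi * (1 / 6)"
      by (intro mult_left_mono assms that) auto
    then have "cos (pi / 3) \<le> cos (2 * pi * (\<bar>t\<bar> * real j))"
      using pi_gt_zero by (intro cos_monotone_0_pi_le) auto
    also have "\<dots> = cos (2 * pi * (- t * real j))"
      by (simp add: abs_if)
    finally show ?thesis by (simp add: Re_e cos_60)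
  qed
  then have "(\<Sum>j=1..m. 1 / 2) \<le> Re (\<Sum>j=1..m. e (- t * real j))"
    unfolding Re_sum by (intro sum_mono) auto
  also have "\<dots> \<le> norm (\<Sum>j=1..m. e (- t * real j))"
    by (rule complex_Re_le_cmod)
  finally show ?thesis by simp
qed

section \<open>The large sieve inequality\<close>

lemma sum_inverse_square_int_le:
  fixes A :: "int set"
  assumes "finite A"
  shows "(\<Sum>j\<in>A. 1 / (1 + (real_of_int j)\<^sup>2)) \<le> 5"
proof -
  \<comment> \<open>The subtracted term makes the induction close: it telescopes, and for
    \<open>n = 0\<close> both sides equal 1.\<close>
  have *: "(\<Sum>j\<in>{- int n..int n}. 1 / (1 + (real_of_int j)\<^sup>2)) \<le> 5 - 4 / (real n + 1)" for n
  proof (induction n)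
    case (Suc n)
    have "{- int (Suc n)..int (Suc n)} = {- int n..int n} \<union> {int (Suc n), - int (Suc n)}"
      by auto
    then have "(\<Sum>j\<in>{- int (Suc n)..int (Suc n)}. 1 / (1 + (real_of_int j)\<^sup>2))
      = (\<Sum>j\<in>{- int n..int n}. 1 / (1 + (real_of_int j)\<^sup>2)) + 2 / (1 + (real n + 1)\<^sup>2)"
      by (simp add: sum.union_disjoint power2_eq_square algebra_simps)
    moreover have "2 / (1 + (real n + 1)\<^sup>2) \<le> 4 / (real n + 1) - 4 / (real n + 2)"
    proof -
      have "4 / (real n + 1) - 4 / (real n + 2) = 2 / ((real n + 1) * (real n + 2) / 2)"
        by (simp add: field_simps)
      moreover have "(real n + 1) * (real n + 2) / 2 \<le> 1 + (real n + 1)\<^sup>2"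
        by (simp add: power2_eq_square field_simps)
      then have "2 / (1 + (real n + 1)\<^sup>2) \<le> 2 / ((real n + 1) * (real n + 2) / 2)"
        by (intro divide_left_mono mult_pos_pos) (auto simp: add_pos_nonneg)
      ultimately show ?thesis by simp
    qed
    ultimately show ?case using Suc by (simp add: add_ac)
  qed simp
  obtain b where b: "\<And>j. j \<in> A \<Longrightarrow> \<bar>j\<bar> \<le> b"
    using finite_imp_Sup_less [OF finite_imageI [OF assms, of abs]]
    by (metis assms finite_imageI image_eqI Max_ge)
  have "(\<Sum>j\<in>A. 1 / (1 + (real_of_int j)\<^sup>2))
      \<le> (\<Sum>j\<in>{- int (nat b)..int (nat b)}. 1 / (1 + (real_of_int j)\<^sup>2))"
    using b by (intro sum_mono2) (force simp: abs_le_iff)+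
  also have "\<dots> \<le> 5"
    using * [of "nat b"] by (rule order_trans) auto
  finally show ?thesis .
qed

text \<open>Half-open intervals of length \<^term>\<open>1 / (2 * real X)\<close> contain at most one point of \<^term>\<open>R\<close> each,
  which bounds the sum by that of \<open>9 * X\<^sup>2 / (1 + j\<^sup>2)\<close> over the integers.\<close>

lemma sum_geometric_e_spaced_le:
  fixes X :: nat and R :: "real set"
  assumes X: "X \<ge> 1" and R: "finite R" and r: "r \<in> R"
    and spaced: "\<And>r s. r \<in> R \<Longrightarrow> s \<in> R \<Longrightarrow> r \<noteq> s \<Longrightarrow> 1 / (2 * real X) \<le> \<bar>r - s\<bar> \<and> \<bar>r - s\<bar> \<le> 1 / 3"
  shows "(\<Sum>s\<in>R. (norm (\<Sum>k<3 * X. e ((r - s) * real k)))\<^sup>2) \<le> 45 * (real X)\<^sup>2"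
proof -
  define j where "j s = \<lfloor>2 * real X * (r - s)\<rfloor>" for s
  have inj: "inj_on j R"
  proof (rule inj_onI, rule ccontr)
    fix s s' assume s: "s \<in> R" "s' \<in> R" "j s = j s'" "s \<noteq> s'"
    have "1 \<le> 2 * real X * \<bar>s - s'\<bar>"
      using spaced [of s s'] s X by (simp add: field_simps)
    also have "\<dots> = \<bar>2 * real X * (r - s) - 2 * real X * (r - s')\<bar>"
      by (simp add: right_diff_distrib [symmetric] abs_mult abs_minus_commute del: right_diff_distrib_numeral)
    also have "\<dots> < 1"
      using s(3) unfolding j_def by linarith
    finally show False by simp
  qed
  have le: "(norm (\<Sum>k<3 * X. e ((r - s) * real k)))\<^sup>2 \<le> 9 * (real X)\<^sup>2 * (1 / (1 + (real_of_int (j s))\<^sup>2))"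
    if s: "s \<in> R" for s
  proof (cases "s = r")
    case True
    \<comment> \<open>Here \<open>j s = 0\<close> and the geometric sum is \<open>3 * X\<close>, so
      equality holds; this dictates the constant 9.\<close>
    then show ?thesis by (simp add: j_def norm_of_nat power2_eq_square)
  next
    case False
    define v where "v = 2 * real X * (r - s)"
    have v: "1 \<le> \<bar>v\<bar>"
    proof -
      have "1 \<le> 2 * real X * \<bar>r - s\<bar>"
        using spaced [of r s] r s False X by (simp add: field_simps)
      then show ?thesis by (simp add: v_def abs_mult)
    qed
    have "\<bar>real_of_int (j s)\<bar> \<le> \<bar>v\<bar> + 1"
      unfolding j_def v_def [symmetric] by linarith
    then have "\<bar>real_of_int (j s)\<bar> \<le> 2 * \<bar>v\<bar>" using v by linarith
    then have "(real_of_int (j s))\<^sup>2 \<le> (2 * \<bar>v\<bar>)\<^sup>2"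
      by (metis abs_ge_zero power2_abs power_mono)
    moreover have "1 \<le> v\<^sup>2"
      using power_mono [OF v, of 2] by simp
    \<comment> \<open>Adding \<open>1 \<le> v\<^sup>2\<close> to
      \<open>j\<^sup>2 \<le> 4 * v\<^sup>2\<close> absorbs the loss from rounding.\<close>
    ultimately have j5: "1 + (real_of_int (j s))\<^sup>2 \<le> 5 * v\<^sup>2"
      by (simp add: power_mult_distrib)
    have "norm (\<Sum>k<3 * X. e ((r - s) * real k)) \<le> 2 / (3 * \<bar>r - s\<bar>)"
      using spaced [of r s] r s False by (intro norm_geometric_e_le) auto
    also have "\<dots> = 4 / 3 * real X / \<bar>v\<bar>"
      unfolding v_def abs_mult using X False by (simp add: field_simps)
    finally have "(norm (\<Sum>k<3 * X. e ((r - s) * real k)))\<^sup>2 \<le> (4 / 3 * real X / \<bar>v\<bar>)\<^sup>2"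
      by (intro power_mono) auto
    \<comment> \<open>The factor \<open>80 / 9\<close> is \<open>5 * (4 / 3)\<^sup>2\<close>, just
      below 9.\<close>
    also have "\<dots> = 80 / 9 * (real X)\<^sup>2 * (1 / (5 * v\<^sup>2))"
      by (simp add: power_mult_distrib power_divide)
    also have "\<dots> \<le> 9 * (real X)\<^sup>2 * (1 / (1 + (real_of_int (j s))\<^sup>2))"
      using j5 v by (intro mult_mono divide_left_mono) (auto intro!: mult_pos_pos add_pos_nonneg)
    finally show ?thesis .
  qed
  have "(\<Sum>s\<in>R. (norm (\<Sum>k<3 * X. e ((r - s) * real k)))\<^sup>2)
      \<le> (\<Sum>s\<in>R. 9 * (real X)\<^sup>2 * (1 / (1 + (real_of_int (j s))\<^sup>2)))"
    by (intro sum_mono le)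
  also have "\<dots> = 9 * (real X)\<^sup>2 * (\<Sum>i\<in>j ` R. 1 / (1 + (real_of_int i)\<^sup>2))"
    by (simp only: sum_distrib_left sum.reindex [OF inj] o_def)
  also have "\<dots> \<le> 9 * (real X)\<^sup>2 * 5"
    by (intro mult_left_mono sum_inverse_square_int_le) (auto simp: R)
  finally show ?thesis by simp
qed

text \<open>Summing over all pairs of indices weights each difference by a Fejer kernel, whose
  exponential sum is nonnegative and decays quadratically.\<close>

lemma dual_large_sieve:
  fixes X :: nat and R :: "real set" and c :: "real \<Rightarrow> complex"
  assumes X: "X \<ge> 1" and R: "finite R"
    and spaced: "\<And>r s. r \<in> R \<Longrightarrow> s \<in> R \<Longrightarrow> r \<noteq> s \<Longrightarrow> 1 / (2 * real X) \<le> \<bar>r - s\<bar> \<and> \<bar>r - s\<bar> \<le> 1 / 3"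
  shows "(\<Sum>n\<in>{- int X..int X}. (norm (\<Sum>r\<in>R. c r * e (r * real_of_int n)))\<^sup>2)
      \<le> 45 * real X * (\<Sum>r\<in>R. (norm (c r))\<^sup>2)"
proof -
  define Z where "Z n = (norm (\<Sum>r\<in>R. c r * e (r * real_of_int n)))\<^sup>2" for n
  define D where "D t = (\<Sum>k<3 * X. e (t * real k))" for t
  define T where "T = (\<Sum>r\<in>R. (norm (c r))\<^sup>2)"
  \<comment> \<open>This symmetry turns the row bound \<open>D\<close> into the column bound
    \<open>D'\<close>.\<close>
  have Dm: "D (- t) = cnj (D t)" for t
    by (simp add: D_def cnj_e)
  have D: "(\<Sum>s\<in>R. (norm (D (r - s)))\<^sup>2) \<le> 45 * (real X)\<^sup>2" if "r \<in> R" for r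
    unfolding D_def by (rule sum_geometric_e_spaced_le [OF X R that spaced])
  have D': "(\<Sum>r\<in>R. (norm (D (r - s)))\<^sup>2) \<le> 45 * (real X)\<^sup>2" if "s \<in> R" for s
  proof -
    have "norm (D (r - s)) = norm (D (s - r))" for r
      using Dm [of "s - r"] by simp
    then show ?thesis using D [OF that] by simp
  qed
  have Z: "complex_of_real (Z (int k - int l))
      = (\<Sum>r\<in>R. \<Sum>s\<in>R. c r * cnj (c s) * (e ((r - s) * real k) * cnj (e ((r - s) * real l))))" for k l
    unfolding Z_def complex_norm_square cnj_sum sum_product
    by (intro sum.cong refl) (simp add: cnj_e e_add [symmetric] algebra_simps)
  have "(\<Sum>k<3 * X. \<Sum>l<3 * X. complex_of_real (Z (int k - int l)))
      = (\<Sum>k<3 * X. \<Sum>l<3 * X. \<Sum>(r, s)\<in>R \<times> R. c r * cnj (c s) * (e ((r - s) * real k) * cnj (e ((r - s) * real l))))"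
    by (simp add: Z sum.cartesian_product)
  also have "\<dots> = (\<Sum>(r, s)\<in>R \<times> R. \<Sum>k<3 * X. \<Sum>l<3 * X. c r * cnj (c s) * (e ((r - s) * real k) * cnj (e ((r - s) * real l))))"
    by (simp only: sum.swap [of _ "R \<times> R" "{..<3 * X}"] case_prod_unfold)
  \<comment> \<open>For fixed \<open>r\<close> and \<open>s\<close> the sums over \<open>k\<close>
    and \<open>l\<close> separate into \<open>D (r - s)\<close> times its conjugate.\<close>
  also have "\<dots> = (\<Sum>(r, s)\<in>R \<times> R. c r * cnj (c s) * of_real ((norm (D (r - s)))\<^sup>2))"
    by (simp only: complex_norm_square D_def cnj_sum sum_product) (simp only: sum_distrib_left)
  also have "\<dots> = (\<Sum>r\<in>R. \<Sum>s\<in>R. c r * cnj (c s) * of_real ((norm (D (r - s)))\<^sup>2))"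
    by (rule sum.cartesian_product [symmetric])
  finally have Z_D: "complex_of_real (\<Sum>k<3 * X. \<Sum>l<3 * X. Z (int k - int l))
      = (\<Sum>r\<in>R. \<Sum>s\<in>R. c r * cnj (c s) * of_real ((norm (D (r - s)))\<^sup>2))"
    by simp
  have "(\<Sum>k<3 * X. \<Sum>l<3 * X. Z (int k - int l))
      \<le> norm (complex_of_real (\<Sum>k<3 * X. \<Sum>l<3 * X. Z (int k - int l)))"
    by (simp only: norm_of_real abs_ge_self)
  also have "\<dots> = norm (\<Sum>r\<in>R. \<Sum>s\<in>R. c r * cnj (c s) * of_real ((norm (D (r - s)))\<^sup>2))"
    by (simp only: Z_D)
  also have "\<dots> \<le> (\<Sum>r\<in>R. \<Sum>s\<in>R. norm (c r) * norm (c s) * (norm (D (r - s)))\<^sup>2)"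
    by (intro sum_norm_le) (simp add: norm_mult norm_power)
  \<comment> \<open>The inequality between arithmetic and geometric means decouples
    \<open>c r\<close> from \<open>c s\<close>, so that row and column sums of the kernel
    suffice.\<close>
  also have "\<dots> \<le> (\<Sum>r\<in>R. \<Sum>s\<in>R. ((norm (c r))\<^sup>2 + (norm (c s))\<^sup>2) / 2 * (norm (D (r - s)))\<^sup>2)"
  proof (intro sum_mono mult_right_mono)
    show "norm (c r) * norm (c s) \<le> ((norm (c r))\<^sup>2 + (norm (c s))\<^sup>2) / 2" for r s
      using sum_squares_bound [of "norm (c r)" "norm (c s)"] by simp
  qed simp
  also have "\<dots> = (\<Sum>r\<in>R. (norm (c r))\<^sup>2 / 2 * (\<Sum>s\<in>R. (norm (D (r - s)))\<^sup>2))
      + (\<Sum>r\<in>R. \<Sum>s\<in>R. (norm (c s))\<^sup>2 / 2 * (norm (D (r - s)))\<^sup>2)"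
    by (simp add: add_divide_distrib distrib_right sum.distrib sum_distrib_left)
  also have "(\<Sum>r\<in>R. \<Sum>s\<in>R. (norm (c s))\<^sup>2 / 2 * (norm (D (r - s)))\<^sup>2)
      = (\<Sum>s\<in>R. (norm (c s))\<^sup>2 / 2 * (\<Sum>r\<in>R. (norm (D (r - s)))\<^sup>2))"
    by (subst sum.swap) (simp add: sum_distrib_left)
  also have "(\<Sum>r\<in>R. (norm (c r))\<^sup>2 / 2 * (\<Sum>s\<in>R. (norm (D (r - s)))\<^sup>2))
      + (\<Sum>s\<in>R. (norm (c s))\<^sup>2 / 2 * (\<Sum>r\<in>R. (norm (D (r - s)))\<^sup>2))
      \<le> (\<Sum>r\<in>R. (norm (c r))\<^sup>2 / 2 * (45 * (real X)\<^sup>2)) + (\<Sum>s\<in>R. (norm (c s))\<^sup>2 / 2 * (45 * (real X)\<^sup>2))"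
    by (intro add_mono sum_mono mult_left_mono D D') auto
  also have "\<dots> = 45 * (real X)\<^sup>2 * T"
    by (simp add: T_def sum_distrib_left sum.distrib [symmetric] mult_ac)
  finally have upper: "(\<Sum>k<3 * X. \<Sum>l<3 * X. Z (int k - int l)) \<le> 45 * (real X)\<^sup>2 * T" .
  have Z0: "0 \<le> Z n" for n by (simp add: Z_def)
  \<comment> \<open>Every \<open>n\<close> in \<open>{- int X..int X}\<close> is a difference
    \<open>k - l\<close> for each of the \<open>X\<close> values of \<open>k\<close> in the middle
    third, with \<open>l = k - n\<close> still below \<open>3 * X\<close>. The other pairs are
    dropped by nonnegativity of \<open>Z\<close>.\<close>
  have "real X * (\<Sum>n\<in>{- int X..int X}. Z n) = (\<Sum>k\<in>{X..<2 * X}. \<Sum>n\<in>{- int X..int X}. Z n)"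
    by simp
  also have "\<dots> \<le> (\<Sum>k\<in>{X..<2 * X}. \<Sum>l<3 * X. Z (int k - int l))"
  proof (intro sum_mono)
    fix k assume k: "k \<in> {X..<2 * X}"
    have "(\<Sum>n\<in>{- int X..int X}. Z n) = (\<Sum>l\<in>{k - X..k + X}. Z (int k - int l))"
      by (rule sum.reindex_bij_witness [of _ "\<lambda>l. int k - int l" "\<lambda>n. nat (int k - n)"]) (use k in auto)
    also have "\<dots> \<le> (\<Sum>l<3 * X. Z (int k - int l))"
      by (intro sum_mono2) (use k Z0 in auto)
    finally show "(\<Sum>n\<in>{- int X..int X}. Z n) \<le> (\<Sum>l<3 * X. Z (int k - int l))" .
  qed
  also have "\<dots> \<le> (\<Sum>k<3 * X. \<Sum>l<3 * X. Z (int k - int l))"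
    by (intro sum_mono2) (auto intro: sum_nonneg Z0)
  also note upper
  finally have "real X * (\<Sum>n\<in>{- int X..int X}. Z n) \<le> real X * (45 * real X * T)"
    by (simp add: power2_eq_square mult_ac)
  then show ?thesis
    using X by (simp add: Z_def T_def)
qed

text \<open>Duality: a bound for a matrix yields the same bound for its transpose, here by
  Cauchy-Schwarz with the sums themselves as dual coefficients.\<close>

lemma large_sieve:
  fixes X :: nat and R :: "real set" and a :: "int \<Rightarrow> complex"
  assumes X: "X \<ge> 1" and R: "finite R" and N: "N \<subseteq> {- int X..int X}"
    and spaced: "\<And>r s. r \<in> R \<Longrightarrow> s \<in> R \<Longrightarrow> r \<noteq> s \<Longrightarrow> 1 / (2 * real X) \<le> \<bar>r - s\<bar> \<and> \<bar>r - s\<bar> \<le> 1 / 3"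
  shows "(\<Sum>r\<in>R. (norm (\<Sum>n\<in>N. a n * e (r * real_of_int n)))\<^sup>2)
      \<le> 45 * real X * (\<Sum>n\<in>N. (norm (a n))\<^sup>2)"
proof -
  define S where "S r = (\<Sum>n\<in>N. a n * e (r * real_of_int n))" for r
  define T where "T = (\<Sum>r\<in>R. (norm (S r))\<^sup>2)"
  define G where "G = (\<Sum>n\<in>N. (norm (a n))\<^sup>2)"
  \<comment> \<open>With the coefficients \<open>cnj (S r)\<close>, pairing \<open>U\<close> with
    \<open>a\<close> reproduces \<open>T\<close>.\<close>
  define U where "U n = (\<Sum>r\<in>R. cnj (S r) * e (r * real_of_int n))" for n
  have T0: "0 \<le> T" by (simp add: T_def sum_nonneg)
  have "complex_of_real T = (\<Sum>r\<in>R. \<Sum>n\<in>N. cnj (S r) * (a n * e (r * real_of_int n)))"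
    by (simp add: T_def complex_norm_square sum_distrib_left [symmetric] S_def [symmetric] mult.commute
        del: of_real_power)
  also have "\<dots> = (\<Sum>n\<in>N. a n * U n)"
    by (subst sum.swap) (simp add: U_def sum_distrib_left mult_ac)
  finally have "T = norm (\<Sum>n\<in>N. a n * U n)"
    using T0 by (metis abs_of_nonneg norm_of_real)
  also have "\<dots> \<le> (\<Sum>n\<in>N. norm (a n) * norm (U n))"
    by (intro sum_norm_le) (simp add: norm_mult)
  finally have "T\<^sup>2 \<le> (\<Sum>n\<in>N. norm (a n) * norm (U n))\<^sup>2"
    using T0 by (intro power_mono)
  also have "\<dots> \<le> G * (\<Sum>n\<in>N. (norm (U n))\<^sup>2)"
    unfolding G_def by (rule Cauchy_Schwarz_ineq_sum)
  also have "\<dots> \<le> G * (45 * real X * T)"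
  proof (rule mult_left_mono)
    have "(\<Sum>n\<in>N. (norm (U n))\<^sup>2) \<le> (\<Sum>n\<in>{- int X..int X}. (norm (U n))\<^sup>2)"
      by (intro sum_mono2 N) auto
    also have "\<dots> \<le> 45 * real X * (\<Sum>r\<in>R. (norm (cnj (S r)))\<^sup>2)"
      unfolding U_def by (rule dual_large_sieve [OF X R spaced])
    finally show "(\<Sum>n\<in>N. (norm (U n))\<^sup>2) \<le> 45 * real X * T"
      by (simp add: T_def)
  qed (simp add: G_def sum_nonneg)
  \<comment> \<open>One factor \<open>T\<close> is cancelled below; the case \<open>T = 0\<close> is
    treated apart.\<close>
  finally have "T * T \<le> (45 * real X * G) * T"
    by (simp add: power2_eq_square mult_ac)
  moreover have "0 \<le> 45 * real X * G"
    by (simp add: G_def sum_nonneg)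
  ultimately have "T \<le> 45 * real X * G"
    using T0 by (cases "T = 0") (auto simp: mult_le_cancel_right)
  then show ?thesis
    by (simp add: T_def G_def S_def)
qed

section \<open>Spacing of the fractions near \<alpha>\<close>

text \<open>Distinct fractions differ by a nonzero integer over the product of their denominators,
  which is at most \<open>Q\<^sup>2\<close>. Both lie within \<open>1 / 6\<close> of \<alpha>,
  whence the upper bound.\<close>

lemma near_fractions_spaced:
  assumes "1 \<le> y" and r: "r \<in> near_fractions \<alpha> y Q" "s \<in> near_fractions \<alpha> y Q" "r \<noteq> s"
  shows "1 / Q\<^sup>2 \<le> \<bar>r - s\<bar>" "\<bar>r - s\<bar> \<le> 1 / 3"
proof -
  obtain a q where q: "r = of_int a / of_int q" "1 \<le> q" "of_int q \<le> Q" "\<bar>\<alpha> - r\<bar> \<le> 1 / (6 * y)"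
    using r(1) unfolding near_fractions_def by blast
  obtain b p where p: "s = of_int b / of_int p" "1 \<le> p" "of_int p \<le> Q" "\<bar>\<alpha> - s\<bar> \<le> 1 / (6 * y)"
    using r(2) unfolding near_fractions_def by blast
  have "1 / (6 * y) \<le> 1 / 6"
    using assms(1) by (simp add: field_simps)
  then show "\<bar>r - s\<bar> \<le> 1 / 3" using q(4) p(4) by linarith
  have pq: "0 < real_of_int q * real_of_int p" using q p by simp
  have eq: "r - s = of_int (a * p - b * q) / (of_int q * of_int p)"
    unfolding q(1) p(1) using q(2) p(2) by (simp add: field_simps)
  then have "a * p - b * q \<noteq> 0"
    using r(3) by (metis div_0 of_int_0 right_minus_eq)
  then have "1 \<le> \<bar>a * p - b * q\<bar>" by linarith
  then have "1 \<le> \<bar>real_of_int (a * p - b * q)\<bar>" by linarith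
  then have "1 / (of_int q * of_int p) \<le> \<bar>r - s\<bar>"
    unfolding eq abs_divide using pq by (simp add: divide_right_mono del: of_int_diff of_int_mult)
  moreover have "real_of_int q * of_int p \<le> Q\<^sup>2"
    unfolding power2_eq_square using q p by (intro mult_mono) auto
  then have "1 / Q\<^sup>2 \<le> 1 / (of_int q * of_int p)"
    using pq by (intro frac_le) auto
  ultimately show "1 / Q\<^sup>2 \<le> \<bar>r - s\<bar>" by simp
qed

section \<open>Exponential sums of the short sums\<close>

text \<open>The finite index set is the same for all \<open>t\<close>, so differences of values of
  \<open>F\<close> can be taken term by term.\<close>

lemma F_eq_sum:
  fixes x :: real
  assumes "\<And>m. f m \<noteq> 0 \<Longrightarrow> 1 \<le> real_of_int m \<and> real_of_int m \<le> x"
  shows "F f t \<beta> = (\<Sum>m\<in>{1..\<lfloor>x\<rfloor>}. if real_of_int m \<le> t then f m * e (\<beta> * real_of_int m) else 0)"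
proof -
  have "m \<in> {1..\<lfloor>x\<rfloor>}" if "f m \<noteq> 0" for m
    using assms [OF that] by (simp add: le_floor_iff)
  then have "F f t \<beta> = (\<Sum>\<^sub>\<infinity>m\<in>{1..\<lfloor>x\<rfloor>}. if real_of_int m \<le> t then f m * e (\<beta> * real_of_int m) else 0)"
    unfolding F_def by (intro infsum_cong_neutral) auto
  then show ?thesis by simp
qed

text \<open>The sequence of short sums is a convolution with the indicator function of an interval of
  length \<open>\<lfloor>y\<rfloor>\<close>, so its exponential sum factors.\<close>

lemma sum_F_between:
  fixes x y :: real
  assumes supp: "\<And>m. f m \<noteq> 0 \<Longrightarrow> 1 \<le> real_of_int m \<and> real_of_int m \<le> x"
    and y: "1 \<le> y"
  shows "(\<Sum>n\<in>{n. - y < real_of_int n \<and> real_of_int n \<le> x}.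
            F_between f (real_of_int n) (real_of_int n + y) \<alpha> * e ((r - \<alpha>) * real_of_int n))
       = F f x r * (\<Sum>j=1..nat \<lfloor>y\<rfloor>. e (- (r - \<alpha>) * real j))"
    (is "sum _ ?N = _")
proof -
  define Y where "Y = \<lfloor>y\<rfloor>"
  have Y: "0 \<le> Y" "real_of_int Y \<le> y"
    using y by (simp_all add: Y_def)
  define h where "h m n = (if n < m \<and> m \<le> n + Y then f m * e (\<alpha> * real_of_int m) * e ((r - \<alpha>) * real_of_int n) else 0)" for m n
  have N: "?N \<subseteq> {\<lfloor>- y\<rfloor>..\<lfloor>x\<rfloor>}"
    by (auto simp: le_floor_iff floor_le_iff)
  then have finN: "finite ?N" by (rule finite_subset) simp
  have F_eq: "F f t \<beta> = (\<Sum>m\<in>{1..\<lfloor>x\<rfloor>}. if real_of_int m \<le> t then f m * e (\<beta> * real_of_int m) else 0)" for t \<beta>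
    by (rule F_eq_sum) (rule supp)
  have F_between: "F_between f (real_of_int n) (real_of_int n + y) \<alpha> * e ((r - \<alpha>) * real_of_int n)
      = (\<Sum>m\<in>{1..\<lfloor>x\<rfloor>}. h m n)" for n
  proof -
    \<comment> \<open>As \<open>m\<close> and \<open>n\<close> are integers, \<open>y\<close> may be
      replaced by its floor.\<close>
    have le: "(real_of_int m \<le> real_of_int n + y) = (m \<le> n + Y)" for m
      unfolding Y_def by linarith
    show ?thesis
      unfolding F_between_def F_eq sum_subtractf [symmetric] sum_distrib_right
      unfolding le of_int_le_iff by (intro sum.cong) (use Y in \<open>auto simp: h_def\<close>)
  qed
  have inner: "(\<Sum>n\<in>?N. h m n) = f m * e (r * real_of_int m) * (\<Sum>j=1..nat Y. e (- (r - \<alpha>) * real j))"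
    if m: "m \<in> {1..\<lfloor>x\<rfloor>}" for m
  proof -
    have "(\<Sum>n\<in>?N. h m n) = (\<Sum>n\<in>{m - Y..<m}. f m * e (\<alpha> * real_of_int m) * e ((r - \<alpha>) * real_of_int n))"
    proof (rule sum.mono_neutral_cong_right [OF finN])
      \<comment> \<open>No shift is cut off: \<open>m \<ge> 1\<close> and \<open>Y \<le> y\<close>
        give \<open>m - Y > - y\<close>, and \<open>n < m\<close> keeps \<open>n\<close> below
        \<open>x\<close>.\<close>
      show "{m - Y..<m} \<subseteq> ?N"
        using m Y by (auto simp: le_floor_iff)
    qed (auto simp: h_def)
    also have "\<dots> = (\<Sum>j=1..nat Y. f m * e (\<alpha> * real_of_int m) * e ((r - \<alpha>) * real_of_int (m - int j)))"
      by (rule sum.reindex_bij_witness [of _ "\<lambda>j. m - int j" "\<lambda>n. nat (m - n)"]) auto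
    \<comment> \<open>With \<open>n = m - j\<close>, the phase \<alpha> cancels in the part
      depending on \<open>m\<close>, which leaves frequency \<open>r\<close>.\<close>
    also have "\<dots> = (\<Sum>j=1..nat Y. f m * e (r * real_of_int m) * e (- (r - \<alpha>) * real j))"
      by (intro sum.cong refl) (simp add: mult.assoc e_add [symmetric] algebra_simps)
    finally show ?thesis by (simp add: sum_distrib_left)
  qed
  have "F f x r = (\<Sum>m\<in>{1..\<lfloor>x\<rfloor>}. f m * e (r * real_of_int m))"
    unfolding F_eq by (intro sum.cong) (auto simp: le_floor_iff)
  then show ?thesis
    unfolding F_between Y_def [symmetric] by (subst sum.swap) (simp add: inner sum_distrib_right)
qed

section \<open>The lower bound for the mean square of short sums\<close>

theorem theorem1p8:
  "\<exists>c::real. c > 0 \<and>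
     (\<forall>(x::real) (\<alpha>::real) (f::int \<Rightarrow> complex) (y::real) (Q::real).
        1 \<le> x \<longrightarrow>
        (\<forall>m. f m \<noteq> 0 \<longrightarrow> 1 \<le> real_of_int m \<and> real_of_int m \<le> x) \<longrightarrow>
        1 \<le> y \<longrightarrow> y \<le> x \<longrightarrow>
        1 \<le> Q \<longrightarrow> Q \<le> x powr (1 / 2) \<longrightarrow>
        (\<Sum>n\<in>{n::int. - y < real_of_int n \<and> real_of_int n \<le> x}.
            (norm (F_between f (real_of_int n) (real_of_int n + y) \<alpha>))\<^sup>2)
          \<ge> c * (y\<^sup>2 / x) * (\<Sum>r\<in>near_fractions \<alpha> y Q. (norm (F f x r))\<^sup>2))"
\<comment> \<open>Here \<open>720 = 45 * 16\<close>: 45 from the large sieve, 16 from the factor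
  \<open>(y / 4)\<^sup>2\<close>.\<close>
proof (intro exI [of _ "1 / 720"] conjI allI impI)
  fix x \<alpha> y Q :: real and f :: "int \<Rightarrow> complex"
  assume x: "1 \<le> x" and supp: "\<forall>m. f m \<noteq> 0 \<longrightarrow> 1 \<le> real_of_int m \<and> real_of_int m \<le> x"
    and y: "1 \<le> y" "y \<le> x" and Q: "1 \<le> Q" "Q \<le> x powr (1 / 2)"
  let ?N = "{n::int. - y < real_of_int n \<and> real_of_int n \<le> x}"
  let ?R = "near_fractions \<alpha> y Q"
  define g where "g n = F_between f (real_of_int n) (real_of_int n + y) \<alpha>" for n :: int
  define G where "G = (\<Sum>n\<in>?N. (norm (g n))\<^sup>2)"
  define T where "T = (\<Sum>r\<in>?R. (norm (F f x r))\<^sup>2)"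
  have G0: "0 \<le> G" by (simp add: G_def sum_nonneg)
  have "(y\<^sup>2 / x) * T \<le> 720 * G"
  proof (cases "finite ?R")
    case False
    \<comment> \<open>A \<open>sum\<close> over an infinite set is 0 by convention, so only
      \<open>0 \<le> G\<close> remains.\<close>
    then show ?thesis using G0 by (simp add: T_def)
  next
    case True
    define X where "X = nat \<lfloor>x\<rfloor>"
    have X: "X \<ge> 1" "real X \<le> x" "x \<le> 2 * real X"
    proof -
      have "1 \<le> \<lfloor>x\<rfloor>" using x by simp
      then show "X \<ge> 1" "real X \<le> x" "x \<le> 2 * real X"
        unfolding X_def by linarith+
    qed
    have "Q\<^sup>2 \<le> (x powr (1 / 2))\<^sup>2"
      using Q by (intro power_mono) auto
    then have Qx: "Q\<^sup>2 \<le> x"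
      using x by (simp add: powr_half_sqrt)
    have spaced: "1 / (2 * real X) \<le> \<bar>r - s\<bar> \<and> \<bar>r - s\<bar> \<le> 1 / 3" if "r \<in> ?R" "s \<in> ?R" "r \<noteq> s" for r s
    proof -
      \<comment> \<open>Since \<open>Q\<^sup>2 \<le> x \<le> 2 * real X\<close>; rounding
        \<open>x\<close> down thus costs the factor 2 in the spacing allowed by
        \<open>large_sieve\<close>.\<close>
      have "1 / (2 * real X) \<le> 1 / Q\<^sup>2"
        using Qx X Q by (intro divide_left_mono) auto
      then show ?thesis
        using near_fractions_spaced [OF y(1) that] by linarith
    qed
    have N: "?N \<subseteq> {- int X..int X}"
      using y x unfolding X_def by (auto; linarith)
    \<comment> \<open>The twist \<open>e (- \<alpha> * of_int n)\<close> moves \<alpha> into the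
      coefficients, so the sieve runs over the points \<open>r\<close>; having modulus 1, it leaves
      \<open>G\<close> unchanged.\<close>
    have F: "(y / 4)\<^sup>2 * (norm (F f x r))\<^sup>2 \<le> (norm (\<Sum>n\<in>?N. g n * e (- \<alpha> * of_int n) * e (r * of_int n)))\<^sup>2"
      if r: "r \<in> ?R" for r
    proof -
      let ?K = "\<Sum>j=1..nat \<lfloor>y\<rfloor>. e (- (r - \<alpha>) * real j)"
      have r6: "\<bar>r - \<alpha>\<bar> \<le> 1 / (6 * y)"
        using r unfolding near_fractions_def by (auto simp: abs_minus_commute)
      have "\<bar>r - \<alpha>\<bar> * real j \<le> 1 / 6" if "j \<in> {1..nat \<lfloor>y\<rfloor>}" for j
      proof -
        have "real j \<le> y" using that y by (auto simp: le_nat_iff le_floor_iff)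
        then have "\<bar>r - \<alpha>\<bar> * real j \<le> 1 / (6 * y) * y"
          using r6 y by (intro mult_mono) auto
        then show ?thesis using y by simp
      qed
      then have "real (nat \<lfloor>y\<rfloor>) / 2 \<le> norm ?K"
        by (rule norm_geometric_e_ge)
      moreover have "1 \<le> \<lfloor>y\<rfloor>" using y by simp
      \<comment> \<open>For \<open>y \<ge> 1\<close> the floor loses at most half of
        \<open>y\<close>, which together with the real part bound \<open>1 / 2\<close> gives
        \<open>y / 4\<close>.\<close>
      then have "y \<le> 2 * real (nat \<lfloor>y\<rfloor>)" by linarith
      ultimately have "y / 4 \<le> norm ?K" by linarith
      then have "y / 4 * norm (F f x r) \<le> norm (F f x r * ?K)"
        unfolding norm_mult by (subst mult.commute) (intro mult_left_mono, auto)
      also have "F f x r * ?K = (\<Sum>n\<in>?N. g n * e ((r - \<alpha>) * of_int n))"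
        unfolding g_def using supp y by (intro sum_F_between [symmetric]) auto
      also have "\<dots> = (\<Sum>n\<in>?N. g n * e (- \<alpha> * of_int n) * e (r * of_int n))"
        by (intro sum.cong refl) (simp add: mult.assoc e_add [symmetric] algebra_simps)
      finally show ?thesis
        unfolding power_mult_distrib [symmetric] using y by (intro power_mono) auto
    qed
    have "(y / 4)\<^sup>2 * T \<le> (\<Sum>r\<in>?R. (norm (\<Sum>n\<in>?N. g n * e (- \<alpha> * of_int n) * e (r * of_int n)))\<^sup>2)"
      unfolding T_def sum_distrib_left by (intro sum_mono F)
    also have "\<dots> \<le> 45 * real X * (\<Sum>n\<in>?N. (norm (g n * e (- \<alpha> * of_int n)))\<^sup>2)"
      by (rule large_sieve [OF X(1) True N spaced])
    also have "\<dots> = 45 * real X * G"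
      by (simp add: G_def norm_mult)
    also have "\<dots> \<le> 45 * x * G"
      using X G0 by (intro mult_right_mono) auto
    finally show ?thesis
      using x by (simp add: field_simps power2_eq_square)
  qed
  then have "y\<^sup>2 / x * T / 720 \<le> 720 * G / 720"
    by (rule divide_right_mono) simp
  then show "1 / 720 * (y\<^sup>2 / x) * T \<le> G" by simp
qed simp

end
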